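(* Consider the Energy Sharing Game $(N,v)$ with admission fees $c_i\ge 0$, $i\in U$, and let $\varepsilon^*$ be its least core value. Suppose $C(N,v)=\emptyset$. Then: (a) $2\tilde\varepsilon<\varepsilon^*\le\tilde\varepsilon$, where $\displaystyle\tilde\varepsilon:=\frac{v(N)-\max\{v(S):S\in\mathcal{P}^a\}}{2}<0$; (b) $\displaystyle \varepsilon^*\le\bar\varepsilon:=\min\Big\{\frac{v(N)}{|N|},\ \frac{v(N)-\max\{v(S):S\in\bar{\mathcal{P}}^a\}}{2}\Big\}$.
   Context: Energy Sharing Game. The player set is $N=U\cup\{a\}$, where $U$ is a finite set of users with $|U|\ge 2$ and $a\notin U$ is the aggregator. Fix an integer $m\ge 1$. Each user $i\in U$ has: a compact set $D_i\subseteq\mathbb{R}^{n_i}\times\mathbb{R}^{2m}_+$, whose points are written $(z_i,y_i)$ with $y_i=[y_i^+,y_i^-]\in\mathbb{R}^m_+\times\mathbb{R}^m_+$, such that $D_i^z=\{z_i\in\mathbb{R}^{n_i}:(z_i,0)\in D_i\}$ is nonempty; a continuous function $f_i:\mathbb{R}^{n_i+2m}\to\mathbb{R}$; and an admission fee $c_i\ge 0$. There is also a continuous function $f_a:\mathbb{R}^m\to\mathbb{R}_+$ with $f_a(0)=0$. Put $b_i=\max\{f_i(z_i,0):z_i\in D_i^z\}$ and, for $S\subseteq N$ with $a\in S$ and $|S\cap U|\ge 2$, $$b_S=\max\Big\{\sum_{i\in S\cap U} [f_i(z_i,y_i)-c_i]+f_a\Big(\sum_{i\in S\cap U}y_i^+\Big):\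 (z_i,y_i)\in D_i\ (i\in S\cap U),\ \sum_{i\in S\cap U}y_i^+=\sum_{i\in S\cap U}y_i^-\Big\}.$$ The characteristic function is $v(S)=b_S-\sum_{i\in S\cap U}b_i$ if $a\in S$ and $|S\cap U|\ge 2$, and $v(S)=0$ for every other $S\subseteq N$. Notation: $\mathcal{P}=\{S\subseteq N:S\ne\emptyset,S\ne N\}$, $\mathcal{P}^a=\{S\in\mathcal{P}:a\in S\}$, $\bar{\mathcal{P}}^a=\{S\in\mathcal{P}^a:|S|=|N|-1\}$. For $x\in\mathbb{R}^{|N|}$, $x(S)=\sum_{i\in S}x_i$. The strong $\varepsilon$-core is $C_\varepsilon(N,v)=\{x\in\mathbb{R}^{|N|}:x(N)=v(N),\ x(S)\ge v(S)+\varepsilon\ \forall S\in\mathcal{P}\}$; the core is $C(N,v)=C_0(N,v)$. The least core value is the largest $\varepsilon\in\mathbb{R}$ with $C_\varepsilon(N,v)\ne\emptyset$. *)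

theory Defs
  imports "HOL-Analysis.Analysis"
begin

definition proper_coalitions :: "'p set \<Rightarrow> 'p set set" where
  "proper_coalitions N = {S. S \<subseteq> N \<and> S \<noteq> {} \<and> S \<noteq> N}"

definition proper_coalitions_with :: "'p set \<Rightarrow> 'p \<Rightarrow> 'p set set" where
  "proper_coalitions_with N a = {S \<in> proper_coalitions N. a \<in> S}"

definition maximal_coalitions_with :: "'p set \<Rightarrow> 'p \<Rightarrow> 'p set set" where
  "maximal_coalitions_with N a = {S \<in> proper_coalitions_with N a. card S = card N - 1}"

(* The real vectors indexed by N are the functions in "extensional N", i.e. with a fixed
   dummy value outside N. *)
definition strong_core :: "real \<Rightarrow> 'p set \<Rightarrow> ('p set \<Rightarrow> real) \<Rightarrow> ('p \<Rightarrow> real) set" where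
  "strong_core \<epsilon> N v =
     {x \<in> extensional N. sum x N = v N \<and> (\<forall>S\<in>proper_coalitions N. sum x S \<ge> v S + \<epsilon>)}"

definition core :: "'p set \<Rightarrow> ('p set \<Rightarrow> real) \<Rightarrow> ('p \<Rightarrow> real) set" where
  "core N v = strong_core 0 N v"

definition least_core_value :: "'p set \<Rightarrow> ('p set \<Rightarrow> real) \<Rightarrow> real" where
  "least_core_value N v = (GREATEST \<epsilon>. strong_core \<epsilon> N v \<noteq> {})"

(* The dimension n i depends on the user i, so R^n is not given by a type but embedded in
   "nat => real" as the sequences vanishing from index n on. Its topology as a subspace of
   "nat => real" (product topology) is the Euclidean one. *)
definition Rn :: "nat \<Rightarrow> (nat \<Rightarrow> real) set" where
  "Rn n = {z. \<forall>k\<ge>n. z k = 0}"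

definition nonneg_orthant :: "(real ^ 'm) set" where
  "nonneg_orthant = {y. \<forall>k. 0 \<le> y $ k}"

(* A decision (z, yp, ym) of a user; the pair (yp, ym) is the vector [y^+, y^-] in R^(2m). *)
type_synonym 'm decision = "(nat \<Rightarrow> real) \<times> (real ^ 'm) \<times> (real ^ 'm)"

locale energy_sharing_game =
  fixes U :: "'p set" and a :: 'p
    and n :: "'p \<Rightarrow> nat"
    and D :: "'p \<Rightarrow> 'm::finite decision set"
    and f :: "'p \<Rightarrow> 'm decision \<Rightarrow> real"
    and c :: "'p \<Rightarrow> real"
    and fa :: "real ^ 'm \<Rightarrow> real"
  assumes finite_U: "finite U"
    and card_U: "card U \<ge> 2"
    and a_notin_U: "a \<notin> U"
    and D_subset: "\<And>i. i \<in> U \<Longrightarrow> D i \<subseteq> Rn (n i) \<times> nonneg_orthant \<times> nonneg_orthant"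
    and D_compact: "\<And>i. i \<in> U \<Longrightarrow> compact (D i)"
    and Dz_nonempty: "\<And>i. i \<in> U \<Longrightarrow> {z. (z, 0, 0) \<in> D i} \<noteq> {}"
    and f_continuous: "\<And>i. i \<in> U \<Longrightarrow> continuous_on (Rn (n i) \<times> UNIV) (f i)"
    and c_nonneg: "\<And>i. i \<in> U \<Longrightarrow> c i \<ge> 0"
    and fa_continuous: "continuous_on UNIV fa"
    and fa_nonneg: "\<And>y. fa y \<ge> 0"
    and fa_0: "fa 0 = 0"

(* GREATEST is the maximum, which is attained under the assumptions of the locale above:
   continuous functions are maximised over nonempty compact sets. *)
definition standalone_value ::
    "('p \<Rightarrow> 'm::finite decision set) \<Rightarrow> ('p \<Rightarrow> 'm decision \<Rightarrow> real) \<Rightarrow> 'p \<Rightarrow> real" where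
  "standalone_value D f i = (GREATEST r. \<exists>z. (z, 0, 0) \<in> D i \<and> r = f i (z, 0, 0))"

definition sharing_value ::
    "'p set \<Rightarrow> ('p \<Rightarrow> 'm::finite decision set) \<Rightarrow> ('p \<Rightarrow> 'm decision \<Rightarrow> real) \<Rightarrow> ('p \<Rightarrow> real)
      \<Rightarrow> (real ^ 'm \<Rightarrow> real) \<Rightarrow> 'p set \<Rightarrow> real" where
  "sharing_value U D f c fa S =
     (GREATEST r. \<exists>z yp ym.
        (\<forall>i\<in>S \<inter> U. (z i, yp i, ym i) \<in> D i) \<and>
        (\<Sum>i\<in>S \<inter> U. yp i) = (\<Sum>i\<in>S \<inter> U. ym i) \<and>
        r = (\<Sum>i\<in>S \<inter> U. (f i (z i, yp i, ym i) - c i)) + fa (\<Sum>i\<in>S \<inter> U. yp i))"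

definition char_fun ::
    "'p set \<Rightarrow> 'p \<Rightarrow> ('p \<Rightarrow> 'm::finite decision set) \<Rightarrow> ('p \<Rightarrow> 'm decision \<Rightarrow> real) \<Rightarrow> ('p \<Rightarrow> real)
      \<Rightarrow> (real ^ 'm \<Rightarrow> real) \<Rightarrow> 'p set \<Rightarrow> real" where
  "char_fun U a D f c fa S =
     (if a \<in> S \<and> card (S \<inter> U) \<ge> 2
      then sharing_value U D f c fa S - (\<Sum>i\<in>S \<inter> U. standalone_value D f i)
      else 0)"

end

theory Submission
  imports Defs
begin

text \<open>
  Everything rests on \<open>v(S) = 0\<close> whenever \<open>a \<notin> S\<close> or \<open>S = {a}\<close>.
  The upper bounds come from adding the constraints of complementary coalitions, respectively of
  all singletons. If \<open>v(N)\<close> were at least \<open>M = max {v(S) : S \<in> P\<^sup>a}\<close>, giving everything to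
  \<open>a\<close> would be a core allocation. Otherwise, charging each user \<open>\<delta> = (M - v(N)) / |N|\<close> and giving
  the proceeds to \<open>a\<close> gives an allocation in the strong \<open>(v(N) - M + \<delta>)\<close>-core, so the lower bound
  is strict.
\<close>

lemma singleton_in_proper_coalitions:
  assumes "card N \<ge> 2" "i \<in> N"
  shows "{i} \<in> proper_coalitions N"
  using assms by (auto simp: proper_coalitions_def)

lemma strong_core_singletons:
  assumes "card N \<ge> 2" "x \<in> strong_core \<epsilon> N v" "i \<in> N"
  shows "v {i} + \<epsilon> \<le> x i"
  using singleton_in_proper_coalitions[OF assms(1,3)] assms(2)
  by (force simp: strong_core_def)

text \<open>With at least two players every singleton is proper, so the singleton constraints can be
  added up and compared with \<open>sum x N = v N\<close>.\<close>

lemma strong_core_le_average: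
  assumes "card N \<ge> 2" "x \<in> strong_core \<epsilon> N v"
  shows "\<epsilon> \<le> (v N - (\<Sum>i\<in>N. v {i})) / real (card N)"
proof -
  have "(\<Sum>i\<in>N. v {i} + \<epsilon>) \<le> sum x N"
    by (intro sum_mono strong_core_singletons[OF assms])
  also have "sum x N = v N"
    using assms(2) by (simp add: strong_core_def)
  finally have "\<epsilon> * real (card N) \<le> v N - (\<Sum>i\<in>N. v {i})"
    by (simp add: sum.distrib mult.commute)
  then show ?thesis
    using assms(1) by (simp add: pos_le_divide_eq)
qed

text \<open>The complement of a proper coalition is proper, and the two constraints add up to a
  bound on \<open>sum x N = v N\<close>.\<close>

lemma strong_core_le_complement:
  assumes "finite N" "x \<in> strong_core \<epsilon> N v" "S \<in> proper_coalitions N"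
  shows "v S + v (N - S) + 2 * \<epsilon> \<le> v N"
proof -
  have S: "S \<subseteq> N" "N - S \<in> proper_coalitions N"
    using assms(3) by (auto simp: proper_coalitions_def)
  have "sum x N = sum x S + sum x (N - S)"
    using sum.subset_diff[OF S(1) assms(1), of x] by simp
  moreover have "v S + \<epsilon> \<le> sum x S" "v (N - S) + \<epsilon> \<le> sum x (N - S)" "sum x N = v N"
    using assms(2,3) S(2) by (auto simp: strong_core_def)
  ultimately show ?thesis by linarith
qed

text \<open>This serves to show that the largest \<epsilon> is attained. Cutting off below at
  \<open>\<epsilon>\<^sub>0\<close> makes the pairs bounded: \<epsilon> by the average bound, each
  \<open>x i\<close> from below by its singleton constraint, and hence from above by
  \<open>sum x N = v N\<close>. The remaining conditions are closed.\<close>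

lemma compact_strong_core_pairs:
  fixes v :: "'p set \<Rightarrow> real"
  assumes "finite N" "card N \<ge> 2"
  shows "compact {(\<epsilon>, x). \<epsilon>\<^sub>0 \<le> \<epsilon> \<and> x \<in> strong_core \<epsilon> N v}"
    (is "compact ?E")
proof -
  define l where "l i = v {i} + \<epsilon>\<^sub>0" for i
  \<comment> \<open>The upper end is what is left of \<open>v N\<close> when all other players get
    their lower bounds. The factor \<open>{undefined}\<close> outside \<open>N\<close> encodes
    \<open>extensional N\<close>, so the full product over \<open>UNIV\<close> is compact by
    Tychonoff.\<close>
  define B where
    "B i = (if i \<in> N then {l i..v N - sum l (N - {i})} else {undefined})" for i
  define I where "I = {\<epsilon>\<^sub>0..(v N - (\<Sum>i\<in>N. v {i})) / real (card N)}"
  define C where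
    "C = {p :: real \<times> ('p \<Rightarrow> real). sum (snd p) N = v N} \<inter>
      (\<Inter>S\<in>proper_coalitions N. {p. v S + fst p \<le> sum (snd p) S})"
  have coord: "continuous_on UNIV (\<lambda>p :: real \<times> ('p \<Rightarrow> real). snd p i)" for i
    using continuous_on_compose2[OF continuous_on_product_coordinates continuous_on_snd[OF continuous_on_id]]
    by simp
  have "compact (Pi\<^sub>E UNIV B)"
    using compactin_PiE[of "\<lambda>_. euclidean" UNIV B]
    by (simp add: euclidean_product_topology B_def)
  then have "compact (I \<times> Pi\<^sub>E UNIV B)"
    unfolding I_def by (intro compact_Times compact_Icc)
  moreover have "closed C"
    unfolding C_def
    by (intro closed_Int closed_INT ballI closed_Collect_eq closed_Collect_le
        continuous_intros coord)
  ultimately have "compact (I \<times> Pi\<^sub>E UNIV B \<inter> C)"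
    by (intro compact_Int_closed)
  moreover have "I \<times> Pi\<^sub>E UNIV B \<inter> C = ?E"
  proof (intro subset_antisym subsetI)
    fix p assume "p \<in> I \<times> Pi\<^sub>E UNIV B \<inter> C"
    then obtain \<epsilon> x where p: "p = (\<epsilon>, x)" "\<epsilon> \<in> I" "x \<in> Pi\<^sub>E UNIV B" "(\<epsilon>, x) \<in> C"
      by (cases p) auto
    have "x \<in> extensional N"
      using p(3) by (auto simp: extensional_def B_def PiE_def Pi_def split: if_splits)
    with p show "p \<in> ?E"
      by (auto simp: I_def C_def strong_core_def)
  next
    fix p assume "p \<in> ?E"
    then obtain \<epsilon> x where p: "p = (\<epsilon>, x)" "\<epsilon>\<^sub>0 \<le> \<epsilon>" "x \<in> strong_core \<epsilon> N v"
      by (cases p) auto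
    then have x: "x \<in> extensional N" "sum x N = v N"
      by (simp_all add: strong_core_def)
    have l: "l i \<le> x i" if "i \<in> N" for i
      using strong_core_singletons[OF assms(2) p(3) that] p(2) by (simp add: l_def)
    have "x i \<in> B i" for i
    proof (cases "i \<in> N")
      case True
      have "sum l (N - {i}) \<le> sum x (N - {i})"
        by (intro sum_mono l) simp
      with True show ?thesis
        using sum.remove[OF assms(1) True, of x] x(2) l[OF True] by (simp add: B_def)
    next
      case False
      with x(1) show ?thesis by (simp add: B_def extensional_def)
    qed
    moreover have "\<epsilon> \<in> I"
      using p(2) strong_core_le_average[OF assms(2) p(3)] by (simp add: I_def)
    moreover have "(\<epsilon>, x) \<in> C"
      using p(3) by (auto simp: C_def strong_core_def)
    ultimately show "p \<in> I \<times> Pi\<^sub>E UNIV B \<inter> C"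
      using p(1) by auto
  qed
  ultimately show ?thesis by simp
qed

text \<open>\<open>GREATEST\<close> is meaningful only if a maximum exists. It does, since the
  projection of the compact set of pairs to \<epsilon> is compact and, by the third assumption,
  nonempty.\<close>

lemma least_core_value:
  assumes "finite N" "card N \<ge> 2" "strong_core \<epsilon>\<^sub>0 N v \<noteq> {}"
  shows strong_core_least_core_value: "strong_core (least_core_value N v) N v \<noteq> {}"
    and le_least_core_value: "\<epsilon>\<^sub>0 \<le> least_core_value N v"
proof -
  let ?E = "{(\<epsilon>, x). \<epsilon>\<^sub>0 \<le> \<epsilon> \<and> x \<in> strong_core \<epsilon> N v}"
  have "compact (fst ` ?E)"
    by (intro compact_continuous_image continuous_intros compact_strong_core_pairs assms)
  moreover have "fst ` ?E \<noteq> {}"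
    using assms(3) by force
  ultimately obtain \<epsilon> where \<epsilon>: "\<epsilon> \<in> fst ` ?E" "\<And>\<epsilon>'. \<epsilon>' \<in> fst ` ?E \<Longrightarrow> \<epsilon>' \<le> \<epsilon>"
    by (meson compact_attains_sup)
  have "strong_core \<epsilon> N v \<noteq> {}" "\<epsilon>\<^sub>0 \<le> \<epsilon>"
    using \<epsilon>(1) by auto
  \<comment> \<open>Values below the cutoff \<open>\<epsilon>\<^sub>0\<close> are not in the
    projection, but cannot exceed its maximum.\<close>
  moreover have "\<epsilon>' \<le> \<epsilon>" if "strong_core \<epsilon>' N v \<noteq> {}" for \<epsilon>'
  proof (cases "\<epsilon>\<^sub>0 \<le> \<epsilon>'")
    case True
    with that have "\<epsilon>' \<in> fst ` ?E" by force
    then show ?thesis by (rule \<epsilon>(2))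
  next
    case False
    with \<open>\<epsilon>\<^sub>0 \<le> \<epsilon>\<close> show ?thesis by simp
  qed
  ultimately have "least_core_value N v = \<epsilon>"
    unfolding least_core_value_def by (intro Greatest_equality)
  then show "strong_core (least_core_value N v) N v \<noteq> {}" "\<epsilon>\<^sub>0 \<le> least_core_value N v"
    using \<open>strong_core \<epsilon> N v \<noteq> {}\<close> \<open>\<epsilon>\<^sub>0 \<le> \<epsilon>\<close> by simp_all
qed

text \<open>Each user pays \<delta> and \<open>a\<close> receives \<open>v N\<close> plus all fees.
  A proper coalition containing \<open>a\<close> lacks at least one user, whose fee it keeps, so it
  gets at least \<open>v N + \<delta>\<close>; a coalition without \<open>a\<close> loses at most
  \<open>card U * \<delta>\<close>.\<close>

lemma strong_core_uniform_fee:
  fixes v :: "'p set \<Rightarrow> real"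
  assumes "finite U" "a \<notin> U" "\<delta> \<ge> 0"
    and without_a: "\<And>S. a \<notin> S \<Longrightarrow> v S = 0"
    and with_a: "\<And>S. S \<in> proper_coalitions_with (insert a U) a \<Longrightarrow> v S + \<epsilon> \<le> v (insert a U) + \<delta>"
    and \<epsilon>: "\<epsilon> \<le> - (real (card U) * \<delta>)"
  shows "strong_core \<epsilon> (insert a U) v \<noteq> {}"
proof -
  define N where "N = insert a U"
  define x where "x = (\<lambda>i\<in>N. if i = a then v N + real (card U) * \<delta> else - \<delta>)"
  have sum_x: "sum x T = - (real (card T) * \<delta>)" if "T \<subseteq> U" for T
  proof -
    have "sum x T = (\<Sum>i\<in>T. - \<delta>)"
      using that assms(2) by (intro sum.cong) (auto simp: x_def N_def)
    then show ?thesis by simp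
  qed
  have x_a: "x a = v N + real (card U) * \<delta>"
    by (simp add: x_def N_def)
  have "v S + \<epsilon> \<le> sum x S" if S: "S \<in> proper_coalitions N" for S
  proof (cases "a \<in> S")
    case True
    define T where "T = S - {a}"
    have T: "S = insert a T" "a \<notin> T" "T \<subset> U"
      using S True assms(2) by (auto simp: T_def N_def proper_coalitions_def)
    have "finite T" using T(3) assms(1) finite_subset by blast
    \<comment> \<open>Strictness of \<open>T \<subset> U\<close>, which comes from
      \<open>S \<noteq> N\<close>, yields the surplus of one \<delta>.\<close>
    have "real (card T) + 1 \<le> real (card U)"
      using psubset_card_mono[OF assms(1) T(3)] by linarith
    then have "(real (card T) + 1) * \<delta> \<le> real (card U) * \<delta>"
      by (rule mult_right_mono) (rule assms(3))
    moreover have "sum x S = x a - real (card T) * \<delta>"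
      using T \<open>finite T\<close> sum_x[of T] by simp
    moreover have "v S + \<epsilon> \<le> v N + \<delta>"
      using with_a[of S] S True by (simp add: N_def proper_coalitions_with_def)
    ultimately show ?thesis
      by (simp add: x_a algebra_simps)
  next
    case False
    then have "S \<subseteq> U" using S by (auto simp: N_def proper_coalitions_def)
    then have "real (card S) * \<delta> \<le> real (card U) * \<delta>"
      using assms(1,3) by (intro mult_right_mono) (simp_all add: card_mono)
    then show ?thesis
      using without_a[OF False] sum_x[OF \<open>S \<subseteq> U\<close>] \<epsilon> by simp
  qed
  moreover have "sum x N = v N"
    using assms(1,2) sum_x[of U] x_a by (simp add: N_def)
  moreover have "x \<in> extensional N"
    by (simp add: x_def)
  ultimately have "x \<in> strong_core \<epsilon> N v"
    by (simp add: strong_core_def)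
  then show ?thesis by (auto simp: N_def)
qed

theorem proposition4:
  fixes U :: "'p set" and a :: 'p and n :: "'p \<Rightarrow> nat"
    and D :: "'p \<Rightarrow> 'm::finite decision set"
    and f :: "'p \<Rightarrow> 'm decision \<Rightarrow> real"
    and c :: "'p \<Rightarrow> real" and fa :: "real ^ 'm \<Rightarrow> real"
  defines "N \<equiv> insert a U"
    and "v \<equiv> char_fun U a D f c fa"
  defines "eps_star \<equiv> least_core_value N v"
    and "eps_tilde \<equiv> (v N - Max (v ` proper_coalitions_with N a)) / 2"
    and "eps_bar \<equiv> min (v N / real (card N))
                      ((v N - Max (v ` maximal_coalitions_with N a)) / 2)"
  assumes game: "energy_sharing_game U a n D f c fa"
    and core_empty: "core N v = {}"
  shows "(2 * eps_tilde < eps_star \<and> eps_star \<le> eps_tilde \<and> eps_tilde < 0)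
    \<and> eps_star \<le> eps_bar"
proof -
  interpret energy_sharing_game U a n D f c fa by (rule game)
  have fin: "finite N" and card_N: "card N = card U + 1" "card N \<ge> 2"
    using finite_U a_notin_U card_U by (simp_all add: N_def)
  have without: "v S = 0" if "a \<notin> S" for S
    using that by (simp add: v_def char_fun_def)
  \<comment> \<open>Even \<open>{a}\<close> has value 0, as a singleton contains fewer than two
    users.\<close>
  have single: "v {i} = 0" for i
  proof -
    have "card ({i} \<inter> U) \<le> 1"
      by (rule order_trans[OF card_mono[of "{i}"]]) auto
    then show ?thesis by (simp add: v_def char_fun_def)
  qed
  define M where "M = Max (v ` proper_coalitions_with N a)"
  have fin_P: "finite (proper_coalitions_with N a)"
    by (rule finite_subset[of _ "Pow N"])
      (use fin in \<open>auto simp: proper_coalitions_with_def proper_coalitions_def\<close>)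
  have a_in: "{a} \<in> proper_coalitions_with N a"
    using singleton_in_proper_coalitions[OF card_N(2), of a]
    by (simp add: N_def proper_coalitions_with_def)
  have v_le_M: "v S \<le> M" if "S \<in> proper_coalitions_with N a" for S
    using that fin_P by (simp add: M_def)
  have less: "v N < M"
  proof (rule ccontr)
    assume "\<not> v N < M"
    then have "strong_core 0 N v \<noteq> {}"
      unfolding N_def
      by (intro strong_core_uniform_fee[where \<delta> = 0] finite_U a_notin_U without)
        (use v_le_M in \<open>force simp: N_def\<close>)+
    with core_empty show False by (simp add: core_def)
  qed
  \<comment> \<open>This fee equalises the two limits on \<epsilon> in the uniform-fee allocation,
    \<open>v N - M + \<delta>\<close> and \<open>- (card U * \<delta>)\<close>.\<close>
  define \<delta> where "\<delta> = (M - v N) / real (card N)"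
  have \<delta>: "\<delta> > 0" "(real (card U) + 1) * \<delta> = M - v N"
    using less card_N by (simp_all add: \<delta>_def add.commute)
  have core: "strong_core (v N - M + \<delta>) N v \<noteq> {}"
    unfolding N_def
  proof (rule strong_core_uniform_fee[where \<delta> = \<delta>])
    show "v S + (v (insert a U) - M + \<delta>) \<le> v (insert a U) + \<delta>"
      if "S \<in> proper_coalitions_with (insert a U) a" for S
      using v_le_M[of S] that by (simp add: N_def)
    show "v (insert a U) - M + \<delta> \<le> - (real (card U) * \<delta>)"
      using \<delta>(2) by (simp add: N_def algebra_simps)
  qed (use finite_U a_notin_U without \<delta>(1) in auto)
  obtain x where x: "x \<in> strong_core eps_star N v"
    using strong_core_least_core_value[OF fin card_N(2) core] by (auto simp: eps_star_def)
  have "v N - M + \<delta> \<le> eps_star"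
    unfolding eps_star_def by (rule le_least_core_value[OF fin card_N(2) core])
  \<comment> \<open>Here \<open>2 * eps_tilde\<close> equals \<open>v N - M\<close>, so strictness
    is exactly \<open>\<delta> > 0\<close>.\<close>
  with \<delta>(1) have lower: "2 * eps_tilde < eps_star"
    by (simp add: eps_tilde_def M_def)
  \<comment> \<open>One argument for both families of coalitions: the maximum is attained at some
    \<open>S\<close> containing \<open>a\<close>, and \<open>N - S\<close> has value 0 because it
    omits \<open>a\<close>.\<close>
  have upper: "eps_star \<le> (v N - Max (v ` A)) / 2"
    if A: "A \<subseteq> proper_coalitions_with N a" "A \<noteq> {}" for A
  proof -
    have "Max (v ` A) \<in> v ` A"
      using A fin_P by (intro Max_in) (auto intro: finite_subset)
    then obtain S where S: "S \<in> A" "Max (v ` A) = v S"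
      by auto
    then have "S \<in> proper_coalitions N" "a \<in> S"
      using A by (auto simp: proper_coalitions_with_def)
    then show ?thesis
      using strong_core_le_complement[OF fin x, of S] without[of "N - S"] S(2) by simp
  qed
  have "eps_star \<le> eps_tilde"
    unfolding eps_tilde_def using a_in by (intro upper) auto
  moreover have "eps_tilde < 0"
    using less by (simp add: eps_tilde_def M_def)
  moreover have "eps_star \<le> v N / real (card N)"
    using strong_core_le_average[OF card_N(2) x] by (simp add: single)
  moreover have "eps_star \<le> (v N - Max (v ` maximal_coalitions_with N a)) / 2"
  proof (rule upper)
    show "maximal_coalitions_with N a \<subseteq> proper_coalitions_with N a"
      by (simp add: maximal_coalitions_with_def)
    \<comment> \<open>Removing a single user leaves a coalition of size \<open>card N - 1\<close>
      that still contains \<open>a\<close>, so the second maximum is over a nonempty family.\<close>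
    obtain i where "i \<in> U" using card_U by fastforce
    then have "N - {i} \<in> maximal_coalitions_with N a"
      using a_notin_U fin
      by (auto simp: N_def maximal_coalitions_with_def proper_coalitions_with_def
          proper_coalitions_def)
    then show "maximal_coalitions_with N a \<noteq> {}" by blast
  qed
  ultimately show ?thesis
    using lower by (simp add: eps_bar_def)
qed

end
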